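(* For every positive integer $\ell$, there exist (a) a planar triangle-free graph $G_\ell$ such that any coloring of the vertices of $G_\ell$ by two colors contains a monochromatic component of diameter at least $\ell$, and (b) a planar graph $G'_\ell$ such that any coloring of the vertices of $G'_\ell$ by three colors contains a monochromatic component of diameter at least $\ell$.
   Context: Graphs are finite and simple. Colorings are not necessarily proper. A monochromatic component is a connected component of the subgraph induced by a color class. The diameter of a monochromatic component is measured inside the component (i.e., the maximum distance between its vertices in the component itself, not in the whole graph). *)

theory Defs
  imports "Graph_Theory.Graph_Theory" "HOL-Analysis.Analysis"
begin

text \<open>
  A finite simple graph is a \<^locale>\<open>pair_graph\<close>: a finite, loop-free, symmetric relation, so that
  an undirected edge is present as both of its orientations.
\<close>

definition edge_set :: "'a pair_pre_digraph \<Rightarrow> 'a set set" where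
  "edge_set G = {{u, v} | u v. (u, v) \<in> parcs G}"

definition triangle_free :: "'a pair_pre_digraph \<Rightarrow> bool" where
  "triangle_free G \<longleftrightarrow>
     \<not> (\<exists>u v w. u \<noteq> v \<and> v \<noteq> w \<and> u \<noteq> w \<and>
          {u, v} \<in> edge_set G \<and> {v, w} \<in> edge_set G \<and> {u, w} \<in> edge_set G)"

text \<open>
  The plane is \<^typ>\<open>complex\<close>. Edges are drawn as arbitrary injective continuous curves; the interior
  of a curve (the curve without the images of the two ends of its edge) meets neither the vertices
  nor any other curve.
\<close>

definition plane_drawing ::
    "'a pair_pre_digraph \<Rightarrow> ('a \<Rightarrow> complex) \<Rightarrow> ('a set \<Rightarrow> real \<Rightarrow> complex) \<Rightarrow> bool" where
  "plane_drawing G p c \<longleftrightarrow>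
     inj_on p (pverts G) \<and>
     (\<forall>e \<in> edge_set G.
        Path_Connected.arc (c e) \<and> {pathstart (c e), pathfinish (c e)} = p ` e \<and>
        (path_image (c e) - p ` e) \<inter> p ` pverts G = {}) \<and>
     (\<forall>e \<in> edge_set G. \<forall>f \<in> edge_set G. e \<noteq> f \<longrightarrow>
        (path_image (c e) - p ` e) \<inter> path_image (c f) = {})"

definition planar :: "'a pair_pre_digraph \<Rightarrow> bool" where
  "planar G \<longleftrightarrow> (\<exists>p c. plane_drawing G p c)"

definition coloring :: "'a pair_pre_digraph \<Rightarrow> nat \<Rightarrow> ('a \<Rightarrow> nat) \<Rightarrow> bool" where
  "coloring G k col \<longleftrightarrow> col \<in> pverts G \<rightarrow> {..<k}"

definition component :: "('a, 'b) pre_digraph \<Rightarrow> ('a, 'b) pre_digraph \<Rightarrow> bool" where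
  "component G H \<longleftrightarrow> pre_digraph.max_subgraph G Digraph_Component.connected H"

definition mono_component ::
    "'a pair_pre_digraph \<Rightarrow> ('a \<Rightarrow> nat) \<Rightarrow> ('a, 'a \<times> 'a) pre_digraph \<Rightarrow> bool" where
  "mono_component G col H \<longleftrightarrow>
     (\<exists>i. component (with_proj G \<restriction> {v \<in> pverts G. col v = i}) H)"

text \<open>
  Both notions below depend only on the graph \<open>H\<close> itself; for a component \<open>H\<close> of a color class they
  measure distances inside the component. Walks are weighted by their number of edges.
\<close>

definition graph_dist :: "('a, 'b) pre_digraph \<Rightarrow> 'a \<Rightarrow> 'a \<Rightarrow> ereal" where
  "graph_dist H u v = wf_digraph.\<mu> H (\<lambda>_. 1) u v"

definition graph_diameter :: "('a, 'b) pre_digraph \<Rightarrow> ereal" where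
  "graph_diameter H = (SUP u \<in> verts H. SUP v \<in> verts H. graph_dist H u v)"

end

theory Submission
  imports Defs
begin

text \<open>
  The graphs are recursive gadgets with two terminals \<open>u\<close>, \<open>v\<close> and a path \<open>x\<^sub>0, \<dots>, x\<^sub>l\<close> whose vertices
  are joined to \<open>u\<close> or \<open>v\<close>: to both of them for three colours, alternately for two colours, which
  keeps the graph triangle-free. Between each terminal and each \<open>x\<^sub>i\<close> sits a copy of the gadget of
  the previous level.

  If the path avoids the colours of both terminals and is monochromatic, it has the required
  diameter. If the terminals have different colours out of three and the path is not like that,
  some \<open>x\<^sub>i\<close> is coloured like a terminal, say \<open>u\<close>. The component of \<open>u\<close> can leave the copy between \<open>v\<close>
  and \<open>x\<^sub>i\<close> only through \<open>x\<^sub>i\<close>, so recursion in this copy reaches vertices farther and farther away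
  from the terminals. If the terminals have equal colours, then some \<open>x\<^sub>i\<close> has that colour as well
  (otherwise, the path is monochromatic or \<open>u\<close> and \<open>x\<^sub>0\<close> have different colours out of three), and so does some \<open>y\<^sub>j\<close> on
  the path of the copy between \<open>u\<close> and \<open>x\<^sub>i\<close>; recursion in the copy between \<open>x\<^sub>i\<close> and \<open>y\<^sub>j\<close>, which
  contains neither \<open>u\<close> nor \<open>v\<close>, again increases the distance.

  Distances are bounded below by functions that grow by at most one along each edge.
\<close>

section \<open>Plane coordinates: terminals, spine and affine copies\<close>

definition tri :: "complex set" where
  "tri = {z. 0 < Re z \<and> 0 < Im z \<and> Re z + Im z < 1}"

definition tip :: "bool \<Rightarrow> complex" where
  "tip s = (if s then \<i> else 1)"

definition spine :: "nat \<Rightarrow> complex" where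
  "spine i = Complex (1 / (real i + 3)) (1 / (real i + 3))"

definition swap :: "bool \<Rightarrow> complex \<Rightarrow> complex" where
  "swap s z = (if s then Complex (Im z) (Re z) else z)"

text \<open>
  The affine map with \<^term>\<open>tip False\<close> to \<^term>\<open>tip s\<close>, \<^term>\<open>tip True\<close> to \<^term>\<open>spine i\<close> and
  \<^term>\<open>0 :: complex\<close> to \<^term>\<open>spine (Suc i)\<close>.
\<close>

definition shrink :: "bool \<Rightarrow> nat \<Rightarrow> complex \<Rightarrow> complex" where
  "shrink s i z = swap s (Re z *\<^sub>R 1 + Im z *\<^sub>R spine i + (1 - Re z - Im z) *\<^sub>R spine (Suc i))"

definition side :: "bool \<Rightarrow> real" where
  "side s = (if s then - 1 else 1)"

text \<open>
  The lines through \<^term>\<open>tip s\<close> are level sets of the second component on their side of the diagonal,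
  so that the vertices, the edges and the copies of a gadget are separated by this invariant.
  Division by zero gives \<^term>\<open>tip s\<close> the value 0.
\<close>

definition key :: "complex \<Rightarrow> real \<times> real" where
  "key z = (sgn (Re z - Im z), (1 - Re z - Im z) / min (Re z) (Im z))"

text \<open>A region between two consecutive lines through \<open>tip s\<close>, containing the
  image of \<open>tri\<close> under \<open>shrink s i\<close>. Described by \<open>key\<close>
  alone, so that disjointness is a comparison of intervals.\<close>

definition cell :: "bool \<Rightarrow> nat \<Rightarrow> complex set" where
  "cell s i = {z. fst (key z) = side s \<and> real i + 1 < snd (key z) \<and> snd (key z) < real i + 2}"

lemma key_tip: "key (tip s) = (side s, 0)"
  by (auto simp: key_def tip_def side_def)

lemma key_spine: "key (spine i) = (0, real i + 1)"
  by (simp add: key_def spine_def divide_simps)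

lemma key_swap: "key (swap s z) = ((if s then - fst (key z) else fst (key z)), snd (key z))"
  by (auto simp: key_def swap_def min.commute sgn_if)

lemma tip_eq [simp]: "tip s = tip s' \<longleftrightarrow> s = s'"
  by (auto simp: tip_def complex_eq_iff)

lemma spine_eq [simp]: "spine i = spine j \<longleftrightarrow> i = j"
  by (auto simp: spine_def)

lemma tip_neq_spine [simp]: "tip s \<noteq> spine i" "spine i \<noteq> tip s"
  by (auto simp: tip_def spine_def complex_eq_iff)

lemma tip_notin_tri [simp]: "tip s \<notin> tri"
  by (auto simp: tri_def tip_def)

lemma spine_in_tri [simp]: "spine i \<in> tri"
  by (simp add: tri_def spine_def divide_simps)

lemma tip_notin_cell [simp]: "tip s \<notin> cell s' i"
  by (simp add: cell_def key_tip)

lemma spine_notin_cell [simp]: "spine j \<notin> cell s i"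
  by (simp add: cell_def key_spine side_def)

lemma cell_disjoint: "z \<in> cell s i \<Longrightarrow> z \<in> cell s' i' \<Longrightarrow> s = s' \<and> i = i'"
  by (auto simp: cell_def side_def split: if_splits)

lemma shrink_tip [simp]: "shrink s i (tip False) = tip s" "shrink s i (tip True) = spine i"
  by (auto simp: shrink_def tip_def swap_def complex_eq_iff spine_def)

text \<open>Up to the swap, the real part minus the imaginary part of the image returns
  \<open>Re z\<close>; then \<open>Im z\<close> is determined because the two spine points
  differ.\<close>

lemma inj_shrink: "inj (shrink s i)"
proof (rule injI)
  fix z w assume eq: "shrink s i z = shrink s i w"
  define A B where "A = 1 / (real i + 3)" and "B = 1 / (real i + 4)"
  define h where "h z = Im z * A + (1 - Re z - Im z) * B" for z
  have "Re z + h z = Re w + h w" "h z = h w"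
    using eq by (auto simp: shrink_def swap_def complex_eq_iff spine_def h_def A_def B_def add_ac split: if_splits)
  then have r: "Re z = Re w" and e: "h z = h w" by auto
  have "(Im z - Im w) * (A - B) = h z - h w"
    unfolding h_def r by (simp add: algebra_simps)
  moreover have "A - B > 0" by (simp add: A_def B_def divide_simps)
  ultimately have "Im z = Im w" using e by simp
  with r show "z = w" by (simp add: complex_eq_iff)
qed

lemma shrink_eq [simp]: "shrink s i z = shrink s i w \<longleftrightarrow> z = w"
  using inj_shrink by (auto dest: injD)

lemma shrink_in_tri: "z \<in> tri \<Longrightarrow> shrink s i z \<in> tri"
proof -
  assume z: "z \<in> tri"
  define g where "g = (1 - Re z - Im z) / (real i + 4)"
  define h where "h = Im z / (real i + 3)"
  have "0 < g" "0 < h" using z by (auto simp: g_def h_def tri_def)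
  moreover have "1 - Re z - Im z = g * (real i + 4)" "Im z = h * (real i + 3)"
    by (auto simp: g_def h_def)
  then have "1 - Re z - Im z = g * real i + 4 * g" "Im z = h * real i + 3 * h"
    by (auto simp: distrib_left)
  moreover have "0 \<le> g * real i" "0 \<le> h * real i" using calculation by auto
  ultimately have "0 < g" "0 < h" "2 * g < 1 - Re z - Im z" "2 * h < Im z" by linarith+
  moreover define w where "w = Re z *\<^sub>R 1 + Im z *\<^sub>R spine i + (1 - Re z - Im z) *\<^sub>R spine (Suc i)"
  moreover have "Re w = Re z + (h + g)" "Im w = h + g"
    by (auto simp: w_def spine_def h_def g_def)
  ultimately have "w \<in> tri"
    using z by (auto simp: tri_def)
  then show ?thesis
    by (auto simp: shrink_def w_def [symmetric] swap_def tri_def)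
qed

lemma shrink_in_cell: "z \<in> tri \<Longrightarrow> shrink s i z \<in> cell s i"
proof -
  assume z: "z \<in> tri"
  define g where "g = (1 - Re z - Im z) / (real i + 4)"
  define h where "h = Im z / (real i + 3)"
  have pos: "0 < g" "0 < h" using z by (auto simp: g_def h_def tri_def)
  have e: "1 - Re z - Im z = g * (real i + 4)" "Im z = h * (real i + 3)"
    by (auto simp: g_def h_def)
  define w where "w = Re z *\<^sub>R 1 + Im z *\<^sub>R spine i + (1 - Re z - Im z) *\<^sub>R spine (Suc i)"
  have w: "Re w = Re z + (h + g)" "Im w = h + g"
    by (auto simp: w_def spine_def h_def g_def)
  \<comment> \<open>The smaller coordinate of \<open>w\<close> is \<open>h + g\<close>, so
    \<open>snd (key w)\<close> is a weighted mean of \<open>i + 1\<close> and \<open>i + 2\<close>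
    with positive weights.\<close>
  have "1 - Re w - Im w = h * (real i + 1) + g * (real i + 2)"
    using e unfolding w by (simp add: algebra_simps)
  moreover have "0 < Re z" using z by (simp add: tri_def)
  ultimately have "fst (key w) = 1" "real i + 1 < snd (key w)" "snd (key w) < real i + 2"
    using pos by (auto simp: key_def w min_def field_simps)
  then show ?thesis
    by (simp add: shrink_def w_def [symmetric] cell_def key_swap side_def)
qed

lemma shrink_affine: "shrink s i ((1 - t) *\<^sub>R a + t *\<^sub>R b) = (1 - t) *\<^sub>R shrink s i a + t *\<^sub>R shrink s i b"
proof -
  have "(1 - t) *\<^sub>R (x::complex) + t *\<^sub>R x = x" for x by (simp add: algebra_simps)
  then show ?thesis
    by (simp add: shrink_def swap_def complex_eq_iff algebra_simps)
qed

lemma shrink_closed_segment: "closed_segment (shrink s i a) (shrink s i b) = shrink s i ` closed_segment a b"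
  by (auto simp: closed_segment_def shrink_affine [symmetric])

lemma shrink_open_segment: "open_segment (shrink s i a) (shrink s i b) = shrink s i ` open_segment a b"
  by (auto simp: open_segment_def shrink_closed_segment)

lemma open_segment_in_tri:
  assumes "a \<in> tri \<union> range tip" "b \<in> tri \<union> range tip" "a \<in> tri \<or> b \<in> tri"
  shows "open_segment a b \<subseteq> tri"
proof -
  have *: "open_segment a b \<subseteq> tri" if a: "a \<in> tri \<union> range tip" and b: "b \<in> tri" for a b
  proof
    fix z assume "z \<in> open_segment a b"
    then obtain t where t: "0 < t" "t < 1" "z = (1 - t) *\<^sub>R a + t *\<^sub>R b"
      by (auto simp: in_segment)
    have a': "0 \<le> Re a" "0 \<le> Im a" "Re a + Im a \<le> 1"
      using a by (auto simp: tri_def tip_def)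
    have b': "0 < Re b" "0 < Im b" "Re b + Im b < 1"
      using b by (auto simp: tri_def)
    have "(1 - t) * (Re a + Im a) + t * (Re b + Im b) < (1 - t) * 1 + t * 1"
      using t a' b' by (intro add_le_less_mono mult_left_mono mult_strict_left_mono) auto
    moreover have "0 < (1 - t) * Re a + t * Re b" "0 < (1 - t) * Im a + t * Im b"
      using t a' b' by (auto intro!: add_nonneg_pos)
    ultimately show "z \<in> tri"
      by (simp add: tri_def t algebra_simps)
  qed
  show ?thesis
    using *[of a b] *[of b a] assms by (auto simp: open_segment_commute)
qed

text \<open>A spoke runs along the level line of its spine end and never crosses the
  diagonal.\<close>

lemma key_open_spoke:
  assumes "z \<in> open_segment (tip s) (spine i)"
  shows "key z = (side s, real i + 1)"
proof -
  obtain t where t: "0 < t" "t < 1" "z = (1 - t) *\<^sub>R tip s + t *\<^sub>R spine i"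
    using assms by (auto simp: in_segment)
  define h where "h = t / (real i + 3)"
  have h: "0 < h" "t = h * (real i + 3)" using t by (auto simp: h_def)
  have "Re z = (if s then 0 else 1 - t) + h" "Im z = (if s then 1 - t else 0) + h"
    by (auto simp: t tip_def spine_def h_def)
  moreover have "1 - t - 2 * h = 1 - h * (real i + 5)" 
    using h by (simp add: algebra_simps)
  ultimately show ?thesis
    using h t(1,2) by (auto simp: key_def side_def min_def field_simps)
qed

lemma key_open_spine:
  assumes "z \<in> open_segment (spine i) (spine (Suc i))"
  shows "fst (key z) = 0" "real i + 1 < snd (key z)" "snd (key z) < real i + 2"
proof -
  obtain t where t: "0 < t" "t < 1" "z = (1 - t) *\<^sub>R spine i + t *\<^sub>R spine (Suc i)"
    using assms by (auto simp: in_segment)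
  define g where "g = (1 - t) / (real i + 3)"
  define h where "h = t / (real i + 4)"
  have p: "0 < g" "0 < h" using t by (auto simp: g_def h_def)
  have z: "Re z = g + h" "Im z = g + h"
    by (auto simp: t spine_def g_def h_def)
  have "g * (real i + 3) + h * (real i + 4) = 1"
    by (simp add: g_def h_def)
  then have "1 - 2 * (g + h) = g * (real i + 1) + h * (real i + 2)"
    by (simp add: algebra_simps)
  then show "fst (key z) = 0" "real i + 1 < snd (key z)" "snd (key z) < real i + 2"
    using p by (auto simp: key_def z field_simps)
qed

section \<open>Distances and components in digraphs\<close>

lemma awalk_length_ge:
  fixes f :: "'a \<Rightarrow> nat"
  assumes "wf_digraph H" "pre_digraph.awalk H u p v"
    and lip: "\<And>e. e \<in> arcs H \<Longrightarrow> f (head H e) \<le> f (tail H e) + 1"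
  shows "f v \<le> f u + length p"
proof -
  interpret wf_digraph H by fact
  show ?thesis using assms(2)
  proof (induction p arbitrary: u)
    case Nil
    then show ?case by (simp add: awalk_Nil_iff)
  next
    case (Cons e p)
    then have "e \<in> arcs H" "tail H e = u" "awalk (head H e) p v"
      by (auto simp: awalk_Cons_iff)
    with Cons.IH [of "head H e"] lip [of e] show ?case by simp
  qed
qed

text \<open>The distance is an infimum over walks, each of which can raise \<open>f\<close> by at
  most its length; without any walk it is infinite.\<close>

lemma graph_dist_ge:
  fixes f :: "'a \<Rightarrow> nat"
  assumes "wf_digraph H"
    and "\<And>e. e \<in> arcs H \<Longrightarrow> f (head H e) \<le> f (tail H e) + 1"
    and "f u + k \<le> f v"
  shows "ereal (real k) \<le> graph_dist H u v"
proof -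
  interpret wf_digraph H by fact
  have "awalk_cost (\<lambda>_. 1) p = real (length p)" for p
    by (induction p) auto
  then show ?thesis
    unfolding graph_dist_def \<mu>_def
    using awalk_length_ge [OF assms(1) _ assms(2)] assms(3)
    by (fastforce intro!: INF_greatest)
qed

lemma component_reachable:
  assumes "sym_digraph G" "a \<in> verts G"
  shows "component G (G \<restriction> {w. a \<rightarrow>\<^sup>*\<^bsub>G\<^esub> w})"
proof -
  interpret sym_digraph G by fact
  let ?H = "G \<restriction> {w. a \<rightarrow>\<^sup>*\<^bsub>G\<^esub> w}"
  have "?H \<in> sccs" using induce_reachable_is_in_sccs assms(2) .
  then have ind: "induced_subgraph ?H G" and sc: "strongly_connected ?H"
    by (auto simp: sccs_def)
  then have sub: "subgraph ?H G" and wf: "wf_digraph ?H"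
    by (auto simp: induced_subgraph_def subgraph_def)
  \<comment> \<open>Maximality: connectedness refers to the symmetrised graph, but \<open>G\<close>
    is symmetric, so every vertex of \<open>H'\<close> is already reachable from \<open>a\<close> in
    \<open>G\<close>.\<close>
  have "H' = ?H" if H': "subgraph ?H H'" "subgraph H' G" "Digraph_Component.connected H'" for H'
  proof -
    interpret H': wf_digraph H' using H' by (auto simp: subgraph_def)
    have a: "a \<in> verts H'"
      using H'(1) assms(2) by (auto simp: subgraph_def)
    have "a \<rightarrow>\<^sup>*\<^bsub>G\<^esub> w" if "w \<in> verts H'" for w
    proof -
      have "a \<rightarrow>\<^sup>*\<^bsub>with_proj (mk_symmetric H')\<^esub> w"
        using H'(3) a that by (auto simp: connected_def strongly_connected_def)
      moreover have "subgraph (mk_symmetric H') (mk_symmetric G)"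
        using H'(2) by (rule subgraph_mk_symmetric)
      ultimately have "a \<rightarrow>\<^sup>*\<^bsub>with_proj (mk_symmetric G)\<^esub> w"
        by (rule pre_digraph.reachable_mono)
      then show ?thesis by (simp add: reachable_mk_symmetric_eq sym_arcs)
    qed
    then have "verts H' = verts ?H"
      using H'(1) by (auto simp: subgraph_def)
    moreover have "arcs H' \<subseteq> arcs ?H"
      using subgraph_induce_subgraphI2 [OF H'(2)] calculation
      by (auto simp: subgraph_def)
    ultimately show ?thesis
      using H'(1,2) by (auto simp: subgraph_def compatible_def pre_digraph.equality intro!: pre_digraph.equality)
  qed
  moreover have "Digraph_Component.connected ?H"
    using sc wf_digraph.reachable_mk_symmetricI [OF wf]
    by (intro wf_digraph.connectedI [OF wf]) (auto simp: strongly_connected_def)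
  ultimately show ?thesis
    using sub unfolding component_def max_subgraph_def by blast
qed

text \<open>The path puts \<open>a\<close> and \<open>b\<close> into one component of the colour
  class, and \<open>f\<close> bounds their distance there from below.\<close>

lemma mono_component_diameter_ge:
  fixes G :: "'a pair_pre_digraph" and f :: "'a \<Rightarrow> nat"
  assumes G: "pair_graph G"
    and lip: "\<And>x y. (x, y) \<in> parcs G \<Longrightarrow> col x = c \<Longrightarrow> col y = c \<Longrightarrow> f y \<le> f x + 1"
    and path: "(a, b) \<in> {(x, y) \<in> parcs G. col x = c \<and> col y = c}\<^sup>*"
    and ab: "f a + k \<le> f b" and "1 \<le> k"
  shows "\<exists>H. mono_component G col H \<and> ereal (real k) \<le> graph_diameter H"
proof -
  interpret pair_graph G by fact
  let ?R = "{(x, y) \<in> parcs G. col x = c \<and> col y = c}"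
  define K where "K = with_proj G \<restriction> {v \<in> pverts G. col v = c}"
  have "induced_subgraph K G"
    unfolding K_def by (rule induced_induce) auto
  then have sym: "sym_digraph K"
    using induced_graph_imp_graph by auto
  then interpret K: sym_digraph K .
  \<comment> \<open>A nontrivial path starts with an arc, which certifies that \<open>a\<close> is a
    vertex of the colour class.\<close>
  have "a \<noteq> b" using ab \<open>1 \<le> k\<close> by auto
  then have "a \<in> Domain ?R" using path by (auto elim: converse_rtranclE)
  then have a: "a \<in> verts K" by (auto simp: K_def dest: in_arcsD1)
  have *: "a \<rightarrow>\<^sup>*\<^bsub>K\<^esub> b" using path
  proof (induction rule: rtrancl_induct)
    case base
    then show ?case using a by (rule K.reachable_refl)
  next
    case (step y z)
    then have "y \<in> pverts G" "z \<in> pverts G" by (auto dest: in_arcsD1 in_arcsD2)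
    with step have "(y, z) \<in> arcs K" by (auto simp: K_def)
    then have "y \<rightarrow>\<^bsub>K\<^esub> z" by (force simp: arcs_ends_def arc_to_ends_def K_def)
    with step.IH show ?case by (rule K.reachable_adj_trans)
  qed
  let ?H = "K \<restriction> {w. a \<rightarrow>\<^sup>*\<^bsub>K\<^esub> w}"
  have "wf_digraph ?H" by (rule K.wellformed_induce_subgraph)
  moreover have "f (head ?H e) \<le> f (tail ?H e) + 1" if "e \<in> arcs ?H" for e
    using that lip [of "fst e" "snd e"] by (auto simp: K_def)
  ultimately have "ereal (real k) \<le> graph_dist ?H a b"
    using ab by (rule graph_dist_ge)
  also have "\<dots> \<le> graph_diameter ?H"
    unfolding graph_diameter_def using * a by (intro SUP_upper2 [of a] SUP_upper2 [of b]) auto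
  finally have "ereal (real k) \<le> graph_diameter ?H" .
  moreover have "mono_component G col ?H"
    unfolding mono_component_def using component_reachable [OF sym a] by (auto simp: K_def)
  ultimately show ?thesis by blast
qed

section \<open>Straight-line drawings\<close>

lemma planar_straight_line:
  fixes G :: "'a pair_pre_digraph" and p :: "'a \<Rightarrow> complex"
  assumes inj: "inj_on p (pverts G)"
    and edges: "\<And>x y. (x, y) \<in> parcs G \<Longrightarrow> x \<noteq> y \<and> x \<in> pverts G \<and> y \<in> pverts G"
    and isolated: "\<And>x. x \<in> pverts G \<Longrightarrow> \<exists>y. (x, y) \<in> parcs G"
    and cross: "\<And>x y x' y'. (x, y) \<in> parcs G \<Longrightarrow> (x', y') \<in> parcs G \<Longrightarrow> {x, y} \<noteq> {x', y'} \<Longrightarrow>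
      open_segment (p x) (p y) \<inter> closed_segment (p x') (p y') = {}"
  shows "planar G"
proof -
  \<comment> \<open>Edges are unordered pairs; the choice fixes one orientation for the segment of
    each.\<close>
  define c where "c e = (let (x, y) = SOME (x, y). (x, y) \<in> parcs G \<and> e = {x, y} in linepath (p x) (p y))" for e
  have c: "\<exists>x y. (x, y) \<in> parcs G \<and> e = {x, y} \<and> c e = linepath (p x) (p y)" if "e \<in> edge_set G" for e
  proof -
    define q where "q = (SOME (x, y). (x, y) \<in> parcs G \<and> e = {x, y})"
    have "\<exists>q. case q of (x, y) \<Rightarrow> (x, y) \<in> parcs G \<and> e = {x, y}"
      using that by (auto simp: edge_set_def)
    then have "case q of (x, y) \<Rightarrow> (x, y) \<in> parcs G \<and> e = {x, y}"
      unfolding q_def by (rule someI_ex)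
    then show ?thesis
      by (auto simp: c_def q_def [symmetric])
  qed
  have "plane_drawing G p c"
    unfolding plane_drawing_def
  proof (intro conjI ballI impI inj)
    fix e assume "e \<in> edge_set G"
    then obtain x y where xy: "(x, y) \<in> parcs G" "e = {x, y}" "c e = linepath (p x) (p y)"
      using c by blast
    then have "p x \<noteq> p y" using edges inj by (auto dest: inj_onD)
    then show "Path_Connected.arc (c e)" by (simp add: xy(3) arc_linepath)
    show "{pathstart (c e), pathfinish (c e)} = p ` e"
      unfolding xy(3) by (simp add: xy(2))
    \<comment> \<open>Every vertex is an end of some segment, so \<open>cross\<close> also keeps
      vertices off the open segments.\<close>
    have "z \<notin> open_segment (p x) (p y)" if z: "z \<in> p ` pverts G" for z
    proof -
      from z obtain w w' where w: "z = p w" "(w, w') \<in> parcs G" using isolated by blast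
      show ?thesis
        using cross [OF xy(1) w(2)] w by (cases "{x, y} = {w, w'}") (auto simp: open_segment_def doubleton_eq_iff)
    qed
    then show "(path_image (c e) - p ` e) \<inter> p ` pverts G = {}"
      unfolding xy(3) by (auto simp: xy(2) open_segment_def)
  next
    fix e e' assume "e \<in> edge_set G" "e' \<in> edge_set G" and ne: "e \<noteq> e'"
    then obtain x y x' y' where "(x, y) \<in> parcs G" "e = {x, y}" "c e = linepath (p x) (p y)"
      "(x', y') \<in> parcs G" "e' = {x', y'}" "c e' = linepath (p x') (p y')"
      using c by meson
    with cross [of x y x' y'] ne show "(path_image (c e) - p ` e) \<inter> path_image (c e') = {}"
      by (auto simp: open_segment_def)
  qed
  then show ?thesis by (auto simp: planar_def)
qed

section \<open>The gadgets and their copies\<close>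

text \<open>The predicate \<open>p\<close> selects the spokes, so that one construction serves both
  theorems: constantly true for three colours, \<open>odd i = s\<close> for two.\<close>

inductive_set half_base :: "(bool \<Rightarrow> nat \<Rightarrow> bool) \<Rightarrow> nat \<Rightarrow> (complex \<times> complex) set" for p l where
  spoke: "i \<le> l \<Longrightarrow> p s i \<Longrightarrow> (tip s, spine i) \<in> half_base p l"
| link: "i < l \<Longrightarrow> (spine i, spine (Suc i)) \<in> half_base p l"

definition base :: "(bool \<Rightarrow> nat \<Rightarrow> bool) \<Rightarrow> nat \<Rightarrow> (complex \<times> complex) set" where
  "base p l = half_base p l \<union> (half_base p l)\<inverse>"

text \<open>Vertices are points of the plane, so copies are glued by mere equality of points: the
  terminals of a copy become \<open>tip s\<close> and \<open>spine i\<close>. A copy is inserted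
  whether or not this pair is joined by a spoke.\<close>

primrec gadget :: "(bool \<Rightarrow> nat \<Rightarrow> bool) \<Rightarrow> nat \<Rightarrow> nat \<Rightarrow> (complex \<times> complex) set" where
  "gadget p l 0 = {}"
| "gadget p l (Suc n) =
     base p l \<union> (\<Union>s. \<Union>i\<in>{..l}. map_prod (shrink s i) (shrink s i) ` gadget p l n)"

lemma base_subset_gadget: "e \<in> base p l \<Longrightarrow> e \<in> gadget p l (Suc n)"
  by simp

lemma shrink_gadget:
  "(x, y) \<in> gadget p l n \<Longrightarrow> i \<le> l \<Longrightarrow> (shrink s i x, shrink s i y) \<in> gadget p l (Suc n)"
  by force

lemma gadget_SucE:
  assumes "(x, y) \<in> gadget p l (Suc n)"
  obtains (base) "(x, y) \<in> base p l"
  | (copy) s i x' y' where "i \<le> l" "(x', y') \<in> gadget p l n" "x = shrink s i x'" "y = shrink s i y'"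
  using assms by auto

lemma base_sym: "(x, y) \<in> base p l \<Longrightarrow> (y, x) \<in> base p l"
  by (auto simp: base_def)

lemma gadget_sym: "(x, y) \<in> gadget p l n \<Longrightarrow> (y, x) \<in> gadget p l n"
proof (induction n arbitrary: x y)
  case (Suc n)
  from Suc.prems show ?case
    by (cases rule: gadget_SucE) (auto intro: base_sym base_subset_gadget shrink_gadget Suc.IH simp del: gadget.simps)
qed simp

lemma finite_half_base: "finite (half_base p l)"
proof (rule finite_subset)
  show "half_base p l \<subseteq> (\<lambda>(s, i). (tip s, spine i)) ` (UNIV \<times> {..l}) \<union> (\<lambda>i. (spine i, spine (Suc i))) ` {..l}"
    by (auto elim!: half_base.cases)
qed auto

lemma finite_gadget: "finite (gadget p l n)"
  by (induction n) (auto simp: base_def finite_half_base)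

lemma base_vertices:
  assumes "(x, y) \<in> base p l"
  shows "x \<in> range tip \<union> range spine" "y \<in> range tip \<union> range spine" "x \<in> range spine \<or> y \<in> range spine" "x \<noteq> y"
  using assms by (auto simp: base_def elim!: half_base.cases)

lemma shrink_vertex:
  assumes "z \<in> tri \<union> range tip"
  shows "z \<in> tri \<and> shrink s i z \<in> cell s i \<or>
    z = tip False \<and> shrink s i z = tip s \<or> z = tip True \<and> shrink s i z = spine i"
proof (cases "z \<in> tri")
  case True
  then show ?thesis by (simp add: shrink_in_cell)
next
  case False
  then obtain s' where "z = tip s'" using assms by auto
  then show ?thesis by (cases s') auto
qed

lemma gadget_vertices:
  assumes "(x, y) \<in> gadget p l n"
  shows "x \<in> tri \<union> range tip \<and> y \<in> tri \<union> range tip \<and> (x \<in> tri \<or> y \<in> tri) \<and> x \<noteq> y"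
  using assms
proof (induction n arbitrary: x y)
  case (Suc n)
  from Suc.prems show ?case
  proof (cases rule: gadget_SucE)
    case base
    from base_vertices [OF this] show ?thesis by auto
  next
    case (copy s i x' y')
    have *: "shrink s i z \<in> tri \<union> range tip" if "z \<in> tri \<union> range tip" for z
      using that shrink_vertex [OF that, of s i] shrink_in_tri [of z s i] by auto
    show ?thesis
      using Suc.IH [OF copy(2)] * [of x'] * [of y'] copy shrink_in_tri by auto
  qed
qed simp

text \<open>Base vertices lie in no cell and cells are disjoint, so an end inside a cell determines
  the copy of an arc.\<close>

lemma gadget_cell:
  assumes "(x, y) \<in> gadget p l (Suc n)" "x \<in> cell s i \<or> y \<in> cell s i"
  shows "i \<le> l \<and> (\<exists>x' y'. x = shrink s i x' \<and> y = shrink s i y' \<and> (x', y') \<in> gadget p l n)"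
  using assms(1)
proof (cases rule: gadget_SucE)
  case base
  from base_vertices [OF this] assms(2) show ?thesis by auto
next
  case (copy s' i' x' y')
  have v: "x' \<in> tri \<union> range tip" "y' \<in> tri \<union> range tip" using gadget_vertices [OF copy(2)] by auto
  have "s' = s \<and> i' = i"
    using assms(2) copy(3,4) shrink_vertex [OF v(1), of s' i'] shrink_vertex [OF v(2), of s' i']
    by (auto dest: cell_disjoint)
  with copy show ?thesis by blast
qed

text \<open>The two terminals of a gadget are not adjacent, so every arc of a copy has an end inside
  its cell.\<close>

lemma gadget_no_cell:
  assumes "(x, y) \<in> gadget p l (Suc n)" "\<And>s i. x \<notin> cell s i" "\<And>s i. y \<notin> cell s i"
  shows "(x, y) \<in> base p l"
  using assms(1)
proof (cases rule: gadget_SucE)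
  case (copy s i x' y')
  then show ?thesis
    using gadget_vertices [OF copy(2)] shrink_in_cell [of x' s i] shrink_in_cell [of y' s i] assms(2,3) by auto
qed

section \<open>Planarity of the gadgets\<close>

lemma key_base:
  assumes "(x, y) \<in> half_base p l" "z \<in> open_segment x y"
  obtains s i where "x = tip s" "y = spine i" "key z = (side s, real i + 1)"
  | i where "x = spine i" "y = spine (Suc i)" "fst (key z) = 0" "real i + 1 < snd (key z)" "snd (key z) < real i + 2"
  using assms by (auto elim!: half_base.cases dest: key_open_spoke key_open_spine)

lemma side_simps [simp]: "side s \<noteq> 0" "0 \<noteq> side s" "side s = side s' \<longleftrightarrow> s = s'"
  by (auto simp: side_def)

text \<open>The keys tell all pieces apart: a spoke has a nonzero side and a positive integer level,
  a link has side 0 and levels strictly between consecutive integers, and vertices have still other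
  keys.\<close>

lemma half_base_no_cross:
  assumes e: "(a, b) \<in> half_base p l" and e': "(a', b') \<in> half_base p l" and ne: "{a, b} \<noteq> {a', b'}"
  shows "open_segment a b \<inter> closed_segment a' b' = {}"
proof -
  have False if z: "z \<in> open_segment a b" "z \<in> closed_segment a' b'" for z
  proof -
    have "z \<in> open_segment a' b' \<or> z = a' \<or> z = b'"
      using z(2) by (auto simp: closed_segment_eq_open)
    moreover have "z \<notin> range tip \<union> range spine"
      using e z(1) by (auto elim!: key_base simp: key_tip key_spine)
    moreover have "a' \<in> range tip \<union> range spine" "b' \<in> range tip \<union> range spine"
      using e' by (auto elim!: half_base.cases)
    ultimately have "z \<in> open_segment a' b'" by auto
    from e z(1) show False
    proof (cases rule: key_base)
      case (1 s i)
      from e' \<open>z \<in> open_segment a' b'\<close> 1 ne show False by (cases rule: key_base) auto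
    next
      case (2 i)
      from e' \<open>z \<in> open_segment a' b'\<close> 2 ne show False by (cases rule: key_base) auto
    qed
  qed
  then show ?thesis by blast
qed

lemma base_no_cross:
  assumes "(a, b) \<in> base p l" "(a', b') \<in> base p l" "{a, b} \<noteq> {a', b'}"
  shows "open_segment a b \<inter> closed_segment a' b' = {}"
proof -
  have "(a, b) \<in> half_base p l \<or> (b, a) \<in> half_base p l" "(a', b') \<in> half_base p l \<or> (b', a') \<in> half_base p l"
    using assms by (auto simp: base_def)
  then show ?thesis
    using half_base_no_cross [of a b p l a' b'] half_base_no_cross [of b a p l a' b']
      half_base_no_cross [of a b p l b' a'] half_base_no_cross [of b a p l b' a'] assms(3)
    by (auto simp: open_segment_commute closed_segment_commute insert_commute)
qed

lemma open_base_no_cell: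
  assumes "(a, b) \<in> base p l" "z \<in> open_segment a b"
  shows "z \<notin> cell s i" "z \<notin> range tip \<union> range spine"
proof -
  have "(a, b) \<in> half_base p l \<or> (b, a) \<in> half_base p l" using assms by (auto simp: base_def)
  moreover have *: "z \<notin> cell s i \<and> z \<notin> range tip \<union> range spine" if "(a, b) \<in> half_base p l" "z \<in> open_segment a b" for a b
    using that by (auto elim!: key_base simp: key_tip key_spine cell_def)
  ultimately show "z \<notin> cell s i" "z \<notin> range tip \<union> range spine"
    using assms(2) open_segment_commute [of a b] by blast+
qed

lemma gadget_open_segment: "(x, y) \<in> gadget p l n \<Longrightarrow> open_segment x y \<subseteq> tri"
  using gadget_vertices [of x y] open_segment_in_tri by blast

text \<open>Arcs of one copy are affine images of arcs of the smaller gadget. In all other cases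
  cells separate: an open segment of a copy stays in its cell, a closed one adds at most the two
  terminals, and base segments avoid every cell.\<close>

lemma gadget_no_cross:
  assumes "(a, b) \<in> gadget p l n" "(a', b') \<in> gadget p l n" "{a, b} \<noteq> {a', b'}"
  shows "open_segment a b \<inter> closed_segment a' b' = {}"
  using assms
proof (induction n arbitrary: a b a' b')
  case (Suc n)
  have op: "open_segment (shrink s i x) (shrink s i y) \<subseteq> cell s i" if "(x, y) \<in> gadget p l n" for s i x y
    using gadget_open_segment [OF that] shrink_in_cell by (auto simp: shrink_open_segment)
  have cl: "closed_segment (shrink s i x) (shrink s i y) \<subseteq> cell s i \<union> {tip s, spine i}"
    if "(x, y) \<in> gadget p l n" for s i x y
    using op [OF that] gadget_vertices [OF that] shrink_vertex [of x s i] shrink_vertex [of y s i]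
    by (auto simp: closed_segment_eq_open)
  from Suc.prems(1) show ?case
  proof (cases rule: gadget_SucE)
    case base1: base
    from Suc.prems(2) show ?thesis
    proof (cases rule: gadget_SucE)
      case base
      with base1 Suc.prems(3) show ?thesis by (intro base_no_cross)
    next
      case (copy s i x y)
      then show ?thesis
        using cl [OF copy(2), of s i] open_base_no_cell [OF base1] unfolding copy(3,4) by blast
    qed
  next
    case copy1: (copy s i x y)
    from Suc.prems(2) show ?thesis
    proof (cases rule: gadget_SucE)
      case base
      have "closed_segment a' b' \<inter> cell s i = {}"
        using base_vertices [OF base] open_base_no_cell(1) [OF base]
        by (auto simp: closed_segment_eq_open)
      then show ?thesis using op [OF copy1(2), of s i] unfolding copy1(3,4) by blast
    next
      case (copy s' i' x' y')
      show ?thesis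
      proof (cases "s = s' \<and> i = i'")
        case True
        have "{x, y} \<noteq> {x', y'}" using Suc.prems(3) copy1 copy True by auto
        then have "open_segment x y \<inter> closed_segment x' y' = {}"
          using Suc.IH copy1 copy by blast
        then show ?thesis
          using True copy1 copy by (auto simp: shrink_open_segment shrink_closed_segment)
      next
        case False
        then have "cell s i \<inter> (cell s' i' \<union> {tip s', spine i'}) = {}"
          by (auto dest: cell_disjoint)
        then show ?thesis
          using op [OF copy1(2), of s i] cl [OF copy(2), of s' i'] unfolding copy1(3,4) copy(3,4) by blast
      qed
    qed
  qed
qed simp

section \<open>Triangle-freeness for alternating spokes\<close>

lemma base_iff [simp]:
  "(tip s, tip s') \<notin> base p l"
  "(tip s, spine i) \<in> base p l \<longleftrightarrow> i \<le> l \<and> p s i"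
  "(spine i, tip s) \<in> base p l \<longleftrightarrow> i \<le> l \<and> p s i"
  "(spine i, spine j) \<in> base p l \<longleftrightarrow> j = Suc i \<and> j \<le> l \<or> i = Suc j \<and> i \<le> l"
  by (auto simp: base_def half_base.simps)

text \<open>The terminals of a copy may be joined by a spoke of the surrounding gadget; hence the
  induction is about the gadget with the terminal edge \<open>T\<close> added.\<close>

lemma gadget_triangle_free:
  fixes l n :: nat
  defines "T \<equiv> {(tip False, tip True), (tip True, tip False)}"
  defines "E \<equiv> \<lambda>n. gadget (\<lambda>s i. odd i = s) l n \<union> T"
  shows "(x, y) \<in> E n \<Longrightarrow> (y, z) \<in> E n \<Longrightarrow> (z, x) \<in> E n \<Longrightarrow> False"
proof (induction n arbitrary: x y z)
  case 0
  have "\<exists>s. u = tip s \<and> v = tip (\<not> s)" if "(u, v) \<in> E 0" for u v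
    using that unfolding E_def T_def by fastforce
  with 0 obtain s s' s'' where "x = tip s" "y = tip (\<not> s)" "y = tip s'" "z = tip (\<not> s')"
    "z = tip s''" "x = tip (\<not> s'')" by metis
  then show ?case by simp
next
  case (Suc n)
  let ?p = "\<lambda>s i. odd i = s"
  have vertices: "u \<in> tri \<union> range tip \<and> v \<in> tri \<union> range tip \<and> u \<noteq> v" if uv: "(u, v) \<in> E n" for u v n
  proof (cases "(u, v) \<in> T")
    case True
    then show ?thesis by (auto simp: T_def)
  next
    case False
    with uv have "(u, v) \<in> gadget ?p l n" by (auto simp: E_def)
    from gadget_vertices [OF this] show ?thesis by blast
  qed
  have in_cell: "\<exists>u' v'. u = shrink s i u' \<and> v = shrink s i v' \<and> (u', v') \<in> E n"
    if uv: "(u, v) \<in> E (Suc n)" and cell: "u \<in> cell s i \<or> v \<in> cell s i" for u v s i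
  proof -
    have "(u, v) \<notin> T" using cell by (auto simp: T_def)
    with uv have "(u, v) \<in> gadget ?p l (Suc n)" unfolding E_def by blast
    from gadget_cell [OF this cell] show ?thesis unfolding E_def by blast
  qed
  \<comment> \<open>A triangle with a vertex inside a cell comes from that copy: its two edges at
    \<open>u\<close> do, and the third either does or joins the terminals, where \<open>T\<close>
    supplies it.\<close>
  have no_cell: "u \<notin> cell s i" if uvw: "(u, v) \<in> E (Suc n)" "(v, w) \<in> E (Suc n)" "(w, u) \<in> E (Suc n)"
    for u v w s i
  proof
    assume u: "u \<in> cell s i"
    obtain u' v' where 1: "u = shrink s i u'" "v = shrink s i v'" "(u', v') \<in> E n"
      using in_cell [OF uvw(1)] u by blast
    obtain w' where 2: "w = shrink s i w'" "(w', u') \<in> E n"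
      using in_cell [OF uvw(3)] u 1(1) by (metis shrink_eq)
    have "(v', w') \<in> E n"
    proof (cases "v \<in> cell s i \<or> w \<in> cell s i")
      case True
      from in_cell [OF uvw(2) this] show ?thesis unfolding 1 2 by auto
    next
      case False
      then have "v' \<notin> tri" "w' \<notin> tri"
        using shrink_in_cell unfolding 1 2 by blast+
      then obtain t t' where "v' = tip t" "w' = tip t'"
        using vertices [OF 1(3)] vertices [OF 2(2)] by blast
      moreover have "v' \<noteq> w'" using vertices [OF uvw(2)] unfolding 1 2 by auto
      ultimately show ?thesis by (cases t; cases t') (auto simp: E_def T_def)
    qed
    then show False using Suc.IH 1(3) 2(2) by blast
  qed
  \<comment> \<open>Only base edges and \<open>T\<close> remain. Each spine vertex sees one terminal
    and consecutive ones see different terminals, so these form no triangle.\<close>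
  note nc = no_cell [OF Suc.prems] no_cell [OF Suc.prems(2,3,1)] no_cell [OF Suc.prems(3,1,2)]
  have e: "(u, v) \<in> base ?p l \<union> T"
    if "(u, v) \<in> E (Suc n)" "\<And>s i. u \<notin> cell s i" "\<And>s i. v \<notin> cell s i" for u v
    using that(1) gadget_no_cell [OF _ that(2,3)] unfolding E_def by blast
  have e: "(x, y) \<in> base ?p l \<union> T" "(y, z) \<in> base ?p l \<union> T" "(z, x) \<in> base ?p l \<union> T"
    using e [OF Suc.prems(1) nc(1,2)] e [OF Suc.prems(2) nc(2,3)] e [OF Suc.prems(3) nc(3,1)] .
  have tip_or_spine: "(\<exists>s. u = tip s) \<or> (\<exists>i. u = spine i)" if "(u, v) \<in> base ?p l \<union> T" for u v
    using that base_vertices(1) [of u v ?p l] by (auto simp: T_def)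
  have T [simp]: "(tip s, tip s') \<in> T \<longleftrightarrow> s \<noteq> s'" "(spine i, u) \<notin> T" "(u, spine i) \<notin> T" for s s' i u
    by (auto simp: T_def)
  have "(\<exists>s. x = tip s) \<or> (\<exists>i. x = spine i)" "(\<exists>s. y = tip s) \<or> (\<exists>i. y = spine i)"
    "(\<exists>s. z = tip s) \<or> (\<exists>i. z = spine i)"
    using e [THEN tip_or_spine] .
  with e show False by (elim disjE exE) auto
qed

section \<open>Certificates for distances in a colour class and their transfer from copies\<close>

definition mono_arcs :: "('a \<times> 'a) set \<Rightarrow> ('a \<Rightarrow> nat) \<Rightarrow> nat \<Rightarrow> ('a \<times> 'a) set" where
  "mono_arcs E col c = {(x, y) \<in> E. col x = c \<and> col y = c}"

definition arc_lipschitz :: "('a \<Rightarrow> nat) \<Rightarrow> ('a \<times> 'a) set \<Rightarrow> bool" where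
  "arc_lipschitz f R \<longleftrightarrow> (\<forall>(x, y) \<in> R. f y \<le> f x + 1)"

text \<open>The terminals get the value 0, so that \<open>f\<close> extends by 0 from a copy to the whole gadget.\<close>

definition spread :: "nat \<Rightarrow> (complex \<times> complex) set \<Rightarrow> (complex \<Rightarrow> nat) \<Rightarrow> bool" where
  "spread k E col \<longleftrightarrow> (\<exists>c f a b. arc_lipschitz f (mono_arcs E col c) \<and> (\<forall>s. f (tip s) = 0) \<and>
     (a, b) \<in> (mono_arcs E col c)\<^sup>* \<and> f a + k \<le> f b)"

text \<open>The path starts at \<open>t\<close> and has its colour. For a terminal \<open>t\<close>,
  where \<open>f\<close> vanishes, the value at \<open>b\<close> bounds the distance from
  \<open>t\<close>.\<close>

definition reach :: "nat \<Rightarrow> (complex \<times> complex) set \<Rightarrow> (complex \<Rightarrow> nat) \<Rightarrow> complex \<Rightarrow> bool" where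
  "reach k E col t \<longleftrightarrow> (\<exists>f b. arc_lipschitz f (mono_arcs E col (col t)) \<and> (\<forall>s. f (tip s) = 0) \<and>
     (t, b) \<in> (mono_arcs E col (col t))\<^sup>* \<and> k \<le> f b)"

lemma reach_imp_spread: "reach k E col (tip s) \<Longrightarrow> spread k E col"
  unfolding reach_def spread_def by fastforce

lemma reach_0: "reach 0 E col t"
  unfolding reach_def arc_lipschitz_def by (intro exI [of _ "\<lambda>_. 0"]) auto

lemma mono_arcs_lift:
  assumes "(a, b) \<in> (mono_arcs (gadget p l n) (col \<circ> shrink s i) c)\<^sup>*" "i \<le> l"
  shows "(shrink s i a, shrink s i b) \<in> (mono_arcs (gadget p l (Suc n)) col c)\<^sup>*"
  using assms(1)
proof (induction rule: rtrancl_induct)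
  case (step y z)
  have "(shrink s i y, shrink s i z) \<in> mono_arcs (gadget p l (Suc n)) col c"
    using step(2) shrink_gadget [OF _ assms(2), of y z p n s] by (auto simp: mono_arcs_def simp del: gadget.simps)
  with step.IH show ?case by (rule rtrancl_into_rtrancl)
qed simp

text \<open>Arcs touching the cell come from the copy, where \<open>h\<close> agrees with
  \<open>f\<close> on colour \<open>c\<close>; all other arcs end at a value of at most 1.\<close>

lemma arc_lipschitz_lift:
  assumes f: "arc_lipschitz f (mono_arcs (gadget p l n) (col \<circ> shrink s i) c)"
    and h: "\<And>z. z \<in> tri \<union> range tip \<Longrightarrow> col (shrink s i z) = c \<Longrightarrow> h (shrink s i z) = f z"
    and out: "\<And>z. z \<notin> cell s i \<Longrightarrow> h z \<le> 1"
  shows "arc_lipschitz h (mono_arcs (gadget p l (Suc n)) col c)"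
  unfolding arc_lipschitz_def
proof (clarify)
  fix x y assume xy: "(x, y) \<in> mono_arcs (gadget p l (Suc n)) col c"
  then have e: "(x, y) \<in> gadget p l (Suc n)" and c: "col x = c" "col y = c"
    by (auto simp: mono_arcs_def)
  show "h y \<le> h x + 1"
  proof (cases "x \<in> cell s i \<or> y \<in> cell s i")
    case True
    then obtain x' y' where *: "x = shrink s i x'" "y = shrink s i y'" "(x', y') \<in> gadget p l n"
      using gadget_cell [OF e] by blast
    with c have "f y' \<le> f x' + 1"
      using f by (auto simp: arc_lipschitz_def mono_arcs_def)
    moreover have "h x = f x'" "h y = f y'"
      using h c * gadget_vertices [OF *(3)] by auto
    ultimately show ?thesis by simp
  next
    case False
    then show ?thesis using out [of y] by simp
  qed
qed

definition unshrink :: "bool \<Rightarrow> nat \<Rightarrow> complex \<Rightarrow> complex" where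
  "unshrink s i = inv (shrink s i)"

lemma unshrink_shrink [simp]: "unshrink s i (shrink s i z) = z"
  by (simp add: unshrink_def inj_shrink)

lemma shrink_in_cell_iff: "z \<in> tri \<union> range tip \<Longrightarrow> shrink s i z \<in> cell s i \<longleftrightarrow> z \<in> tri"
  using shrink_vertex [of z s i] by auto

lemma arc_lipschitz_lift_0:
  assumes "arc_lipschitz f (mono_arcs (gadget p l n) (col \<circ> shrink s i) c)" "\<forall>s. f (tip s) = 0"
  shows "arc_lipschitz (\<lambda>z. if z \<in> cell s i then f (unshrink s i z) else 0) (mono_arcs (gadget p l (Suc n)) col c)"
  using assms by (intro arc_lipschitz_lift [OF assms(1)]) (auto simp: shrink_in_cell_iff)

lemma mono_arcs_vertex:
  assumes "(a, b) \<in> (mono_arcs (gadget p l n) col c)\<^sup>*" "a \<in> tri \<union> range tip"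
  shows "b \<in> tri \<union> range tip"
  using assms by (induction rule: rtrancl_induct) (auto simp: mono_arcs_def dest: gadget_vertices)

lemma lift_0_shrink:
  fixes f :: "complex \<Rightarrow> nat"
  assumes "\<forall>s. f (tip s) = 0" "z \<in> tri \<union> range tip"
  shows "(if shrink s i z \<in> cell s i then f (unshrink s i (shrink s i z)) else 0) = f z"
  using assms by (auto simp: shrink_in_cell_iff)

lemma spread_lift:
  assumes "spread k (gadget p l n) (col \<circ> shrink s i)" "i \<le> l"
  shows "spread k (gadget p l (Suc n)) col"
\<comment> \<open>For positive \<open>k\<close> the path is nontrivial, so its ends are vertices of
  the copy, where the extension by 0 agrees with \<open>f\<close>.\<close>
proof (cases "k = 0")
  case True
  then show ?thesis unfolding spread_def arc_lipschitz_def by (intro exI [of _ 0] exI [of _ "\<lambda>_. 0"]) auto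
next
  case False
  from assms(1) obtain c f a b where f: "arc_lipschitz f (mono_arcs (gadget p l n) (col \<circ> shrink s i) c)" "\<forall>s. f (tip s) = 0"
    and ab: "(a, b) \<in> (mono_arcs (gadget p l n) (col \<circ> shrink s i) c)\<^sup>*" "f a + k \<le> f b"
    unfolding spread_def by blast
  have "a \<noteq> b" using ab(2) False by auto
  then obtain y where "(a, y) \<in> mono_arcs (gadget p l n) (col \<circ> shrink s i) c"
    using ab(1) by (meson converse_rtranclE)
  then have "(a, y) \<in> gadget p l n" by (simp add: mono_arcs_def)
  from gadget_vertices [OF this] have a: "a \<in> tri \<union> range tip" ..
  define h where "h = (\<lambda>z. if z \<in> cell s i then f (unshrink s i z) else 0)"
  have "h (shrink s i a) = f a" "h (shrink s i b) = f b"
    unfolding h_def by (rule lift_0_shrink [OF f(2) a], rule lift_0_shrink [OF f(2) mono_arcs_vertex [OF ab(1) a]])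
  then have "h (shrink s i a) + k \<le> h (shrink s i b)" using ab(2) by simp
  moreover have "\<forall>s. h (tip s) = 0" by (simp add: h_def)
  moreover have "arc_lipschitz h (mono_arcs (gadget p l (Suc n)) col c)"
    unfolding h_def using f by (rule arc_lipschitz_lift_0)
  ultimately show ?thesis
    unfolding spread_def using mono_arcs_lift [OF ab(1) assms(2)] by blast
qed

lemma reach_lift:
  assumes "reach k (gadget p l n) (col \<circ> shrink s i) (tip False)" "i \<le> l"
  shows "reach k (gadget p l (Suc n)) col (tip s)"
proof -
  from assms(1) obtain f b where f: "arc_lipschitz f (mono_arcs (gadget p l n) (col \<circ> shrink s i) (col (tip s)))"
      "\<forall>s. f (tip s) = 0"
    and b: "(tip False, b) \<in> (mono_arcs (gadget p l n) (col \<circ> shrink s i) (col (tip s)))\<^sup>*" "k \<le> f b"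
    unfolding reach_def by auto
  define h where "h = (\<lambda>z. if z \<in> cell s i then f (unshrink s i z) else 0)"
  have "h (shrink s i b) = f b"
    unfolding h_def using f(2) mono_arcs_vertex [OF b(1)] by (intro lift_0_shrink) auto
  then have "k \<le> h (shrink s i b)" using b(2) by simp
  moreover have "(tip s, shrink s i b) \<in> (mono_arcs (gadget p l (Suc n)) col (col (tip s)))\<^sup>*"
    using mono_arcs_lift [OF b(1) assms(2)] by simp
  moreover have "\<forall>s. h (tip s) = 0" by (simp add: h_def)
  moreover have "arc_lipschitz h (mono_arcs (gadget p l (Suc n)) col (col (tip s)))"
    unfolding h_def using f by (rule arc_lipschitz_lift_0)
  ultimately show ?thesis
    unfolding reach_def by blast
qed

text \<open>The copy between \<^term>\<open>tip (\<not> s)\<close> and a spine vertex is left towards \<^term>\<open>tip s\<close> only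
  through the spine vertex, so all distances grow by one.\<close>

lemma arc_lipschitz_lift_Suc:
  assumes f: "arc_lipschitz f (mono_arcs (gadget p l n) (col \<circ> shrink s i) c)" "\<forall>s. f (tip s) = 0"
    and "col (tip s) = c \<Longrightarrow> m = 1" and "m \<le> 1"
  shows "arc_lipschitz (\<lambda>z. if z \<in> cell s i then f (unshrink s i z) + 1
      else if z = tip (\<not> s) then 0 else if z = tip s then m else 1) (mono_arcs (gadget p l (Suc n)) col c)"
proof (rule arc_lipschitz_lift)
  show "arc_lipschitz (\<lambda>z. f z + 1) (mono_arcs (gadget p l n) (col \<circ> shrink s i) c)"
    using f(1) by (auto simp: arc_lipschitz_def)
next
  fix z assume "z \<in> tri \<union> range tip" "col (shrink s i z) = c"
  then show "(if shrink s i z \<in> cell s i then f (unshrink s i (shrink s i z)) + 1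
      else if shrink s i z = tip (\<not> s) then 0 else if shrink s i z = tip s then m else 1) = f z + 1"
    using assms(2,3) shrink_vertex [of z s i] by auto
qed (use \<open>m \<le> 1\<close> in auto)

section \<open>Colouring arguments\<close>

text \<open>The path goes along the spoke to \<open>spine i\<close> and on into the copy between
  \<open>spine i\<close> and the other terminal, whose different colour blocks that second way
  out.\<close>

lemma reach_step:
  assumes reach: "reach k (gadget p l n) (col \<circ> shrink (\<not> s) i) (tip True)" and i: "i \<le> l" "p s i"
    and col: "col (spine i) = col (tip s)" "col (tip (\<not> s)) \<noteq> col (tip s)"
  shows "reach (Suc k) (gadget p l (Suc n)) col (tip s)"
proof -
  let ?c = "col (tip s)"
  from reach col obtain f b where f: "arc_lipschitz f (mono_arcs (gadget p l n) (col \<circ> shrink (\<not> s) i) ?c)"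
      "\<forall>s. f (tip s) = 0"
    and b: "(tip True, b) \<in> (mono_arcs (gadget p l n) (col \<circ> shrink (\<not> s) i) ?c)\<^sup>*" "k \<le> f b"
    unfolding reach_def by auto
  define h where "h = (\<lambda>z. if z \<in> cell (\<not> s) i then f (unshrink (\<not> s) i z) + 1
      else if z = tip (\<not> \<not> s) then 0 else if z = tip (\<not> s) then 0 else 1)"
  have arc_lipschitz: "arc_lipschitz h (mono_arcs (gadget p l (Suc n)) col ?c)"
    unfolding h_def using f col by (intro arc_lipschitz_lift_Suc) auto
  have tip: "\<forall>s. h (tip s) = 0" by (auto simp: h_def)
  have conn: "(spine i, shrink (\<not> s) i b) \<in> (mono_arcs (gadget p l (Suc n)) col ?c)\<^sup>*"
    using mono_arcs_lift [OF b(1) i(1)] by simp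
  have "(tip s, spine i) \<in> mono_arcs (gadget p l (Suc n)) col ?c"
    using i col by (simp add: mono_arcs_def)
  then have conn': "(tip s, shrink (\<not> s) i b) \<in> (mono_arcs (gadget p l (Suc n)) col ?c)\<^sup>*"
    using conn by (rule converse_rtrancl_into_rtrancl)
  have "b \<in> tri \<union> range tip" using mono_arcs_vertex [OF b(1)] by simp
  moreover have "col (shrink (\<not> s) i b) = ?c"
    using conn col(1) by (auto elim!: rtranclE simp: mono_arcs_def)
  ultimately have "h (shrink (\<not> s) i b) = f b + 1"
    using f(2) col shrink_vertex [of b "\<not> s" i] by (auto simp: h_def shrink_in_cell_iff)
  then have "Suc k \<le> h (shrink (\<not> s) i b)" using b(2) by simp
  then show ?thesis
    unfolding reach_def using arc_lipschitz tip conn' by blast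
qed

text \<open>No terminal has colour \<open>e\<close>, so within this colour copies at different spine
  vertices communicate only along the spine.\<close>

lemma spine_spread:
  assumes spine: "\<And>i. i \<le> l \<Longrightarrow> col (spine i) = e" and tips: "\<And>s. col (tip s) \<noteq> e"
  shows "spread l (gadget p l (Suc n)) col"
proof -
  \<comment> \<open>\<open>f\<close> is \<open>i\<close> at \<^term>\<open>spine i\<close> and on the two copies attached to it.\<close>
  define f where "f z = nat (\<lfloor>snd (key z)\<rfloor> - 1)" for z
  have f_tip: "f (tip s) = 0" for s by (simp add: f_def key_tip)
  have f_spine: "f (spine i) = i" for i by (simp add: f_def key_spine)
  have f_cell: "f z = i" if "z \<in> cell s i" for z s i
  proof -
    have "\<lfloor>snd (key z)\<rfloor> = int i + 1"
      using that by (intro floor_unique) (auto simp: cell_def)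
    then show ?thesis by (simp add: f_def)
  qed
  have "f y \<le> f x + 1" if xy: "(x, y) \<in> mono_arcs (gadget p l (Suc n)) col e" for x y
  proof -
    have e: "(x, y) \<in> gadget p l (Suc n)" and c: "col x = e" "col y = e"
      using xy by (auto simp: mono_arcs_def)
    from e show ?thesis
    proof (cases rule: gadget_SucE)
      case base
      with tips c show ?thesis
        by (auto simp: base_def f_spine elim!: half_base.cases)
    next
      case (copy s i x' y')
      have "f (shrink s i z) = i" if "z \<in> tri \<union> range tip" "col (shrink s i z) = e" for z
        using shrink_vertex [OF that(1), of s i] tips [of s] that(2) f_cell f_spine by auto
      with copy c gadget_vertices [OF copy(2)] show ?thesis by auto
    qed
  qed
  then have "arc_lipschitz f (mono_arcs (gadget p l (Suc n)) col e)" by (auto simp: arc_lipschitz_def)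
  moreover have "(spine 0, spine i) \<in> (mono_arcs (gadget p l (Suc n)) col e)\<^sup>*" if "i \<le> l" for i
    using that
  proof (induction i)
    case (Suc i)
    then have "(spine i, spine (Suc i)) \<in> mono_arcs (gadget p l (Suc n)) col e"
      using spine by (simp add: mono_arcs_def)
    with Suc show ?case by (simp add: rtrancl_into_rtrancl)
  qed simp
  moreover have "f (spine 0) + l \<le> f (spine l)" by (simp add: f_spine)
  ultimately show ?thesis
    unfolding spread_def using f_tip by blast
qed

text \<open>The innermost copy has the terminals \<open>spine i\<close> and
  \<open>shrink False i (spine j)\<close>. Neither is a terminal of the outer gadget, so entering it
  costs at least one edge.\<close>

lemma reach_double_step:
  assumes reach: "reach k (gadget p l n) (col \<circ> shrink False i \<circ> shrink True j) (tip s')"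
    and i: "i \<le> l" and j: "j \<le> l" and cover: "\<And>i. i \<le> l \<Longrightarrow> \<exists>s. p s i"
    and col: "\<And>s. col (tip s) = c" "col (spine i) = c" "col (shrink False i (spine j)) = c"
  shows "\<exists>s. reach (Suc k) (gadget p l (Suc (Suc n))) col (tip s)"
proof -
  let ?col1 = "col \<circ> shrink False i"
  let ?col2 = "?col1 \<circ> shrink True j"
  let ?E1 = "mono_arcs (gadget p l (Suc n)) ?col1 c" and ?E = "mono_arcs (gadget p l (Suc (Suc n))) col c"
  have "?col2 (tip s') = c" using col by (cases s') auto
  with reach obtain f b where f: "arc_lipschitz f (mono_arcs (gadget p l n) ?col2 c)" "\<forall>s. f (tip s) = 0"
    and b: "(tip s', b) \<in> (mono_arcs (gadget p l n) ?col2 c)\<^sup>*" "k \<le> f b"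
    unfolding reach_def by auto
  let ?b = "shrink True j b"
  \<comment> \<open>At this level \<open>tip True\<close> stands for \<open>spine i\<close>, which
    has colour \<open>c\<close> and gets the value 1; \<open>tip False\<close> is a true terminal
    and keeps 0.\<close>
  define g where "g z = (if z \<in> cell True j then f (unshrink True j z) + 1
      else if z = tip (\<not> True) then 0 else if z = tip True then 1 else 1)" for z
  have g: "arc_lipschitz g ?E1"
    unfolding g_def by (rule arc_lipschitz_lift_Suc [OF f]) auto
  have g_tip: "g (tip s) = (if s then 1 else 0)" for s by (auto simp: g_def)
  have "b \<in> tri \<union> range tip" using mono_arcs_vertex [OF b(1)] by simp
  then have gb: "g ?b = f b + 1"
    using f(2) shrink_vertex [of b True j] by (auto simp: g_def shrink_in_cell_iff)
  have conn1: "(shrink True j (tip s'), ?b) \<in> ?E1\<^sup>*"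
    using mono_arcs_lift [OF b(1) j] .
  \<comment> \<open>The start is either a terminal of this level already or \<open>spine j\<close>,
    which \<open>cover\<close> joins to a terminal by a spoke.\<close>
  have "\<exists>s. (tip s, shrink True j (tip s')) \<in> ?E1\<^sup>*"
  proof (cases s')
    case True
    from cover [OF j] obtain s where "p s j" ..
    moreover have "?col1 (tip s) = c" using col by (cases s) auto
    ultimately have "(tip s, spine j) \<in> ?E1" using j col by (simp add: mono_arcs_def)
    with True show ?thesis by auto
  qed auto
  then obtain s1 where conn1: "(tip s1, ?b) \<in> ?E1\<^sup>*" using conn1 by (blast intro: rtrancl_trans)
  then have b1: "?b \<in> tri \<union> range tip" by (rule mono_arcs_vertex) simp
  define h where "h z = (if z \<in> cell False i then g (unshrink False i z) else if z = spine i then 1 else 0)" for z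
  have h: "arc_lipschitz h ?E"
    using g
  proof (rule arc_lipschitz_lift)
    fix z assume "z \<in> tri \<union> range tip"
    then show "h (shrink False i z) = g z"
      using shrink_vertex [of z False i] by (auto simp: h_def g_tip)
  qed (auto simp: h_def)
  have h_tip: "\<forall>s. h (tip s) = 0" by (simp add: h_def)
  have hb: "h (shrink False i ?b) = f b + 1"
    using b1 shrink_vertex [of ?b False i] gb by (auto simp: h_def g_tip)
  have conn2: "(shrink False i (tip s1), shrink False i ?b) \<in> ?E\<^sup>*"
    using mono_arcs_lift [OF conn1 i] .
  have "\<exists>s. (tip s, shrink False i (tip s1)) \<in> ?E\<^sup>*"
  proof (cases s1)
    case True
    from cover [OF i] obtain s where "p s i" ..
    then have "(tip s, spine i) \<in> ?E" using i col by (simp add: mono_arcs_def)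
    with True show ?thesis by auto
  qed auto
  then obtain s where "(tip s, shrink False i ?b) \<in> ?E\<^sup>*" using conn2 by (blast intro: rtrancl_trans)
  moreover have "Suc k \<le> h (shrink False i ?b)" using hb b(2) by simp
  ultimately have "reach (Suc k) (gadget p l (Suc (Suc n))) col (tip s)"
    unfolding reach_def col(1) using h h_tip by blast
  then show ?thesis ..
qed

text \<open>By \<open>hyp\<close>, a gadget deeper than \<open>N\<close> with equal terminals and no
  \<open>spread\<close> has a spine vertex in their colour. Using this on two nested levels permits
  a double step, so each unit of distance costs two levels.\<close>

lemma same_spread_or_reach:
  assumes cover: "\<And>i. i \<le> l \<Longrightarrow> \<exists>s. p s i"
    and hyp: "\<And>n col. N < n \<Longrightarrow> (\<And>z. col z < q) \<Longrightarrow> col (tip False) = col (tip True) \<Longrightarrow>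
      (\<And>i. i \<le> l \<Longrightarrow> col (spine i) \<noteq> col (tip False)) \<Longrightarrow> spread l (gadget p l n) col"
    and "N + 2 * k \<le> n" "\<And>z. col z < q" "col (tip False) = col (tip True)"
  shows "spread l (gadget p l n) col \<or> (\<exists>s. reach k (gadget p l n) col (tip s))"
  using assms(3-)
proof (induction k arbitrary: n col)
  case 0
  then show ?case by (auto simp: reach_0)
next
  case (Suc k)
  define m where "m = n - 2"
  have n: "n = Suc (Suc m)" and m: "N + 2 * k \<le> m"
    using Suc.prems(1) by (auto simp: m_def)
  let ?c = "col (tip False)"
  show ?case
  proof (cases "spread l (gadget p l n) col")
    case no_spread: False
    then obtain i where i: "i \<le> l" "col (spine i) = ?c"
      using hyp [of n col] Suc.prems by auto
    let ?col1 = "col \<circ> shrink False i"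
    have no_spread1: "\<not> spread l (gadget p l (Suc m)) ?col1"
      using no_spread spread_lift [of l p l "Suc m"] i unfolding n by blast
    then obtain j where j: "j \<le> l" "?col1 (spine j) = ?c"
      using hyp [of "Suc m" ?col1] Suc.prems i m by auto
    let ?col2 = "?col1 \<circ> shrink True j"
    have no_spread2: "\<not> spread l (gadget p l m) ?col2"
      using no_spread1 spread_lift j by blast
    moreover have "spread l (gadget p l m) ?col2 \<or> (\<exists>s. reach k (gadget p l m) ?col2 (tip s))"
      by (rule Suc.IH) (use m i j Suc.prems in auto)
    ultimately obtain s' where s': "reach k (gadget p l m) ?col2 (tip s')"
      by blast
    have "col (tip s) = ?c" for s using Suc.prems by (cases s) auto
    with reach_double_step [OF s' i(1) j(1) cover] i j Suc.prems show ?thesis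
      unfolding n by auto
  qed simp
qed

lemma same_spread:
  assumes "\<And>i. i \<le> l \<Longrightarrow> \<exists>s. p s i"
    and "\<And>n col. N < n \<Longrightarrow> (\<And>z. col z < q) \<Longrightarrow> col (tip False) = col (tip True) \<Longrightarrow>
      (\<And>i. i \<le> l \<Longrightarrow> col (spine i) \<noteq> col (tip False)) \<Longrightarrow> spread l (gadget p l n) col"
    and "N + 2 * l \<le> n" "\<And>z. col z < q" "col (tip False) = col (tip True)"
  shows "spread l (gadget p l n) col"
  using same_spread_or_reach [OF assms] reach_imp_spread by blast

lemma two_colours_spread:
  assumes col: "\<And>z. col z < (2::nat)" and n: "2 * l < n"
  shows "spread l (gadget (\<lambda>s i. odd i = s) l n) col"
proof -
  let ?p = "\<lambda>s i. odd i = s"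
  have same: "spread l (gadget ?p l n) col"
    if "2 * l \<le> n" and "\<And>z. col z < (2::nat)" and "col (tip False) = col (tip True)" for n col
  proof (rule same_spread)
    fix n :: nat and col :: "complex \<Rightarrow> nat"
    assume n: "0 < n" and col: "\<And>z. col z < 2" "col (tip False) = col (tip True)"
      "\<And>i. i \<le> l \<Longrightarrow> col (spine i) \<noteq> col (tip False)"
    have tips: "col (tip s) = col (tip False)" for s using col(2) by (cases s) auto
    \<comment> \<open>With colours 0 and 1, this is the other colour.\<close>
    have "col (spine i) = 1 - col (tip False)" if "i \<le> l" for i
      using col(1) [of "spine i"] col(1) [of "tip False"] col(3) [OF that] by linarith
    moreover have "col (tip s) \<noteq> 1 - col (tip False)" for s
      using tips [of s] col(1) [of "tip False"] by presburger
    ultimately have "spread l (gadget ?p l (Suc (n - 1))) col"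
      by (rule spine_spread)
    with n show "spread l (gadget ?p l n) col" by simp
  qed (use that in auto)
  obtain m where m: "n = Suc m" "2 * l \<le> m" using n by (cases n) auto
  show ?thesis
  proof (cases "col (tip False) = col (tip True)")
    case True
    with same col n show ?thesis by simp
  next
    case False
    \<comment> \<open>Two different terminals exhaust the colours, so some copy at
      \<open>spine 0\<close> has equal terminals; passing to it costs one level.\<close>
    have "\<exists>s. col (spine 0) = col (tip s)"
    proof (rule ccontr)
      assume "\<nexists>s. col (spine 0) = col (tip s)"
      then have "col (spine 0) \<noteq> col (tip False)" "col (spine 0) \<noteq> col (tip True)" by blast+
      with False col [of "spine 0"] col [of "tip False"] col [of "tip True"] show False by linarith
    qed
    then obtain s where "col (spine 0) = col (tip s)" ..
    then have "spread l (gadget ?p l m) (col \<circ> shrink s 0)"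
      using m col by (intro same) auto
    then show ?thesis unfolding m(1) by (rule spread_lift) simp
  qed
qed

text \<open>The induction carries a target distance for each terminal. A level with both targets
  positive lowers their sum or yields \<open>spread\<close>, so a depth above the sum
  suffices.\<close>

lemma distinct_spread_or_reach:
  assumes "\<And>z. col z < (3::nat)" "col (tip False) \<noteq> col (tip True)" "k False + k True < n"
  shows "spread l (gadget (\<lambda>_ _. True) l n) col \<or> (\<exists>s. reach (k s) (gadget (\<lambda>_ _. True) l n) col (tip s))"
  using assms
proof (induction n arbitrary: col k)
  case (Suc n)
  let ?p = "\<lambda>(_::bool) (_::nat). True"
  have tips: "col (tip (\<not> s)) \<noteq> col (tip s)" for s
    using Suc.prems(2) by (cases s) auto
  consider (zero) s where "k s = 0"
    | (hit) s i where "0 < k s" "i \<le> l" "col (spine i) = col (tip s)"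
    | (miss) "\<And>s i. i \<le> l \<Longrightarrow> col (spine i) \<noteq> col (tip s)"
    by blast
  then show ?case
  proof cases
    case zero
    then show ?thesis using reach_0 by metis
  next
    case hit
    \<comment> \<open>In the copy between \<open>tip (\<not> s)\<close> and \<open>spine i\<close>,
      \<open>tip True\<close> is the spine vertex coloured like \<open>tip s\<close>: its target
      drops by one, the other is kept.\<close>
    define k' where "k' t = (if t then k s - 1 else k (\<not> s))" for t
    have "k s + k (\<not> s) = k False + k True" by (cases s) auto
    then have "k' False + k' True < n" using Suc.prems(3) hit(1) by (simp add: k'_def)
    moreover have "(col \<circ> shrink (\<not> s) i) (tip False) \<noteq> (col \<circ> shrink (\<not> s) i) (tip True)"
      using tips hit by simp
    ultimately have "spread l (gadget ?p l n) (col \<circ> shrink (\<not> s) i) \<or>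
        (\<exists>t. reach (k' t) (gadget ?p l n) (col \<circ> shrink (\<not> s) i) (tip t))"
      using Suc.prems(1) by (intro Suc.IH) auto
    then consider "spread l (gadget ?p l n) (col \<circ> shrink (\<not> s) i)"
      | t where "reach (k' t) (gadget ?p l n) (col \<circ> shrink (\<not> s) i) (tip t)"
      by blast
    then show ?thesis
    proof cases
      case 1
      then show ?thesis using spread_lift hit(2) by blast
    next
      case (2 t)
      show ?thesis
      proof (cases t)
        case True
        have "reach (Suc (k s - 1)) (gadget ?p l (Suc n)) col (tip s)"
          using 2 True hit tips by (intro reach_step [of _ _ _ _ _ _ i]) (auto simp: k'_def)
        then show ?thesis using hit(1) by (metis Suc_pred')
      next
        case False
        then have "reach (k (\<not> s)) (gadget ?p l (Suc n)) col (tip (\<not> s))"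
          using 2 hit(2) by (intro reach_lift) (auto simp: k'_def)
        then show ?thesis by blast
      qed
    qed
  next
    case miss
    \<comment> \<open>The colours 0, 1, 2 sum to 3, so this is the third colour.\<close>
    have "col (spine i) = 3 - col (tip False) - col (tip True)" if "i \<le> l" for i
      using Suc.prems(1) [of "spine i"] Suc.prems(1) [of "tip False"] Suc.prems(1) [of "tip True"]
        Suc.prems(2) miss [OF that, of False] miss [OF that, of True] by linarith
    moreover have "col (spine 0) \<noteq> col (tip s)" for s using miss by simp
    ultimately have "spread l (gadget ?p l (Suc n)) col"
      by (intro spine_spread [of l col "col (spine 0)"]) (auto dest: sym)
    then show ?thesis ..
  qed
qed simp

lemma distinct_spread:
  assumes "\<And>z. col z < (3::nat)" "col (tip False) \<noteq> col (tip True)" "2 * l < n"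
  shows "spread l (gadget (\<lambda>_ _. True) l n) col"
  using distinct_spread_or_reach [of col "\<lambda>_. l" n l] assms reach_imp_spread by auto

lemma three_colours_spread:
  assumes col: "\<And>z. col z < (3::nat)" and n: "4 * l + 1 < n"
  shows "spread l (gadget (\<lambda>_ _. True) l n) col"
proof (cases "col (tip False) = col (tip True)")
  case True
  show ?thesis
  proof (rule same_spread)
    fix n :: nat and col :: "complex \<Rightarrow> nat"
    \<comment> \<open>One level leads to the copy between \<open>tip False\<close> and
      \<open>spine 0\<close>, whose terminals differ; more than \<open>2 * l\<close> levels are left
      for \<open>distinct_spread\<close>.\<close>
    assume n: "2 * l + 1 < n" and col: "\<And>z. col z < 3"
      and spine: "\<And>i. i \<le> l \<Longrightarrow> col (spine i) \<noteq> col (tip False)"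
    obtain m where m: "n = Suc m" "2 * l < m" using n by (cases n) auto
    have "spread l (gadget (\<lambda>_ _. True) l m) (col \<circ> shrink False 0)"
      using col spine [of 0] m by (intro distinct_spread) (auto dest: sym)
    then show "spread l (gadget (\<lambda>_ _. True) l n) col"
      unfolding m(1) by (rule spread_lift) simp
  qed (use n col True in auto)
next
  case False
  then show ?thesis using distinct_spread col n by simp
qed


section \<open>Transfer to graphs on natural numbers\<close>

lemma nat_copy_of_gadget:
  assumes "1 \<le> l" "0 < q" and spread: "\<And>col. (\<And>z. col z < q) \<Longrightarrow> spread l (gadget p l n) col"
  obtains G :: "nat pair_pre_digraph" and g :: "complex \<Rightarrow> nat"
  where "pair_graph G" "planar G" "inj_on g (Field (gadget p l n))"
    "parcs G = map_prod g g ` gadget p l n"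
    "\<forall>col. coloring G q col \<longrightarrow> (\<exists>H. mono_component G col H \<and> ereal (real l) \<le> graph_diameter H)"
proof -
  let ?E = "gadget p l n"
  let ?V = "Field ?E"
  obtain g :: "complex \<Rightarrow> nat" where g: "inj_on g ?V"
    using finite_imp_inj_to_nat_seg [of ?V] finite_Field [OF finite_gadget] by metis
  define G where "G = \<lparr>pverts = g ` ?V, parcs = map_prod g g ` ?E\<rparr>"
  have V: "x \<in> ?V" "y \<in> ?V" if "(x, y) \<in> ?E" for x y
    using that by (auto simp: Field_def)
  have g_eq: "g x = g y \<longleftrightarrow> x = y" if "x \<in> ?V" "y \<in> ?V" for x y
    using g that by (auto dest: inj_onD)
  have arcs_iff: "(g x, g y) \<in> parcs G \<longleftrightarrow> (x, y) \<in> ?E" if "x \<in> ?V" "y \<in> ?V" for x y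
    using that V g_eq by (auto simp: G_def) 
  have arcsE: "\<exists>x y. e = (g x, g y) \<and> (x, y) \<in> ?E" if "e \<in> parcs G" for e
    using that by (auto simp: G_def)
  have graph: "pair_graph G"
  proof
    show "finite (pverts G)" "finite (parcs G)"
      by (auto simp: G_def finite_gadget finite_Field)
    show "fst e \<in> pverts G" "snd e \<in> pverts G" "fst e \<noteq> snd e" if "e \<in> parcs G" for e
      using arcsE [OF that] V g_eq gadget_vertices by (fastforce simp: G_def)+
    show "symmetric (with_proj G)"
    proof (simp add: symmetric_def arcs_ends_def arc_to_ends_def, rule symI)
      fix x y assume "(x, y) \<in> parcs G"
      then show "(y, x) \<in> parcs G" using arcsE gadget_sym by (fastforce simp: G_def)
    qed
  qed
  \<comment> \<open>Returning each number to its point of the plane gives the straight-line drawing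
    and carries \<open>f\<close> over to \<open>G\<close>.\<close>
  define h where "h = inv_into ?V g"
  have hg: "h (g x) = x" if "x \<in> ?V" for x
    using g that by (simp add: h_def)
  have planar: "planar G"
  proof (rule planar_straight_line)
    show "inj_on h (pverts G)"
      by (auto simp: G_def hg intro!: inj_onI)
    fix x y assume xy: "(x, y) \<in> parcs G"
    then obtain u v where u: "x = g u" "y = g v" "(u, v) \<in> ?E" using arcsE by blast
    show "x \<noteq> y \<and> x \<in> pverts G \<and> y \<in> pverts G"
      using u V [OF u(3)] g_eq gadget_vertices [OF u(3)] by (auto simp: G_def)
    fix x' y' assume "(x', y') \<in> parcs G" and ne: "{x, y} \<noteq> {x', y'}"
    then obtain u' v' where u': "x' = g u'" "y' = g v'" "(u', v') \<in> ?E" using arcsE by blast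
    have "{u, v} \<noteq> {u', v'}" using ne u u' by auto
    then show "open_segment (h x) (h y) \<inter> closed_segment (h x') (h y') = {}"
      using gadget_no_cross [OF u(3) u'(3)] V [OF u(3)] V [OF u'(3)] u u' hg by simp
  next
    fix x assume "x \<in> pverts G"
    then obtain u where u: "x = g u" "u \<in> ?V" by (auto simp: G_def)
    from u(2) obtain v where "(u, v) \<in> ?E \<or> (v, u) \<in> ?E" by (auto simp: Field_def)
    then have "(u, v) \<in> ?E" using gadget_sym by blast
    then have "(x, g v) \<in> parcs G" using arcs_iff u V by blast
    then show "\<exists>y. (x, y) \<in> parcs G" ..
  qed
  have "\<exists>H. mono_component G col H \<and> ereal (real l) \<le> graph_diameter H" if col: "coloring G q col" for col
  proof -
    \<comment> \<open>The hypothesis \<open>spread\<close> wants a total colouring; the default 0 is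
      legal since \<open>q\<close> is positive.\<close>
    define col' where "col' z = (if z \<in> ?V then col (g z) else 0)" for z
    have "spread l ?E col'"
      using col \<open>0 < q\<close> by (intro spread) (auto simp: col'_def coloring_def G_def)
    then obtain c f a b where f: "arc_lipschitz f (mono_arcs ?E col' c)"
      and ab: "(a, b) \<in> (mono_arcs ?E col' c)\<^sup>*" "f a + l \<le> f b"
      unfolding spread_def by blast
    have "a \<noteq> b" using ab(2) \<open>1 \<le> l\<close> by auto
    let ?R = "{(x, y) \<in> parcs G. col x = c \<and> col y = c}"
    have arc: "(g x, g y) \<in> ?R" if "(x, y) \<in> mono_arcs ?E col' c" for x y
      using that V arcs_iff by (auto simp: mono_arcs_def col'_def split: if_splits)
    have path: "(g a, g b) \<in> ?R\<^sup>*"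
      using ab(1)
    proof (induction rule: rtrancl_induct)
      case (step y z)
      from step.IH arc [OF step.hyps(2)] show ?case by (rule rtrancl_into_rtrancl)
    qed simp
    obtain y where "(a, y) \<in> mono_arcs ?E col' c" using ab(1) \<open>a \<noteq> b\<close> by (meson converse_rtranclE)
    then have aV: "a \<in> ?V" using V by (auto simp: mono_arcs_def)
    obtain y where "(y, b) \<in> mono_arcs ?E col' c" using ab(1) \<open>a \<noteq> b\<close> by (meson rtranclE)
    then have bV: "b \<in> ?V" using V by (auto simp: mono_arcs_def)
    show ?thesis
    proof (rule mono_component_diameter_ge [OF graph _ path, of "f \<circ> h"])
      fix x y assume xy: "(x, y) \<in> parcs G" "col x = c" "col y = c"
      then obtain u v where u: "x = g u" "y = g v" "(u, v) \<in> ?E" using arcsE by blast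
      then have "(u, v) \<in> mono_arcs ?E col' c" using xy V by (auto simp: mono_arcs_def col'_def)
      then show "(f \<circ> h) y \<le> (f \<circ> h) x + 1"
        using f u V [OF u(3)] by (auto simp: arc_lipschitz_def hg)
    qed (use ab aV bV hg \<open>1 \<le> l\<close> in auto)
  qed
  with graph planar g show thesis by (intro that) (auto simp: G_def)
qed

lemma triangle_free_nat_copy:
  fixes G :: "nat pair_pre_digraph"
  assumes g: "inj_on g (Field (gadget (\<lambda>s i. odd i = s) l n))"
    and G: "parcs G = map_prod g g ` gadget (\<lambda>s i. odd i = s) l n"
  shows "triangle_free G"
proof -
  let ?E = "gadget (\<lambda>s i. odd i = s) l n"
  have arcsE: "\<exists>u v. x = g u \<and> y = g v \<and> (u, v) \<in> ?E" if "{x, y} \<in> edge_set G" for x y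
  proof -
    have "(x, y) \<in> parcs G \<or> (y, x) \<in> parcs G"
      using that by (auto simp: edge_set_def doubleton_eq_iff)
    then show ?thesis unfolding G using gadget_sym by fastforce
  qed
  have False if xyz: "{x, y} \<in> edge_set G" "{y, z} \<in> edge_set G" "{x, z} \<in> edge_set G" for x y z
  proof -
    obtain u v where 1: "x = g u" "y = g v" "(u, v) \<in> ?E" using arcsE [OF xyz(1)] by blast
    obtain v' w where 2: "y = g v'" "z = g w" "(v', w) \<in> ?E" using arcsE [OF xyz(2)] by blast
    obtain u' w' where 3: "x = g u'" "z = g w'" "(u', w') \<in> ?E" using arcsE [OF xyz(3)] by blast
    have "v = v'" "w = w'" "u = u'"
      using 1 2 3 by (auto intro!: inj_onD [OF g] simp: Field_def)
    then show False
      using gadget_triangle_free [of u v l n w] 1(3) 2(3) gadget_sym [OF 3(3)] by blast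
  qed
  then show ?thesis unfolding triangle_free_def by blast
qed

theorem mainTheorem3:
  fixes l :: nat
  assumes "l \<ge> 1"
  shows "(\<exists>G :: nat pair_pre_digraph. pair_graph G \<and> planar G \<and> triangle_free G \<and>
            (\<forall>col. coloring G 2 col \<longrightarrow>
               (\<exists>H. mono_component G col H \<and> graph_diameter H \<ge> ereal (real l)))) \<and>
         (\<exists>G' :: nat pair_pre_digraph. pair_graph G' \<and> planar G' \<and>
            (\<forall>col. coloring G' 3 col \<longrightarrow>
               (\<exists>H. mono_component G' col H \<and> graph_diameter H \<ge> ereal (real l))))"
proof (intro conjI)
  \<comment> \<open>Depth: two levels per unit of distance and one to reach equal terminals.\<close>
  have colours2: "spread l (gadget (\<lambda>s i. odd i = s) l (Suc (2 * l))) col" if "\<And>z. col z < 2" for col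
    using that by (rule two_colours_spread) simp
  obtain G :: "nat pair_pre_digraph" and g :: "complex \<Rightarrow> nat" where G:
      "pair_graph G" "planar G"
      "inj_on g (Field (gadget (\<lambda>s i. odd i = s) l (Suc (2 * l))))"
      "parcs G = map_prod g g ` gadget (\<lambda>s i. odd i = s) l (Suc (2 * l))"
      "\<forall>col. coloring G 2 col \<longrightarrow> (\<exists>H. mono_component G col H \<and> ereal (real l) \<le> graph_diameter H)"
    by (rule nat_copy_of_gadget [OF assms zero_less_numeral colours2]) blast+
  with triangle_free_nat_copy [OF G(3,4)]
  show "\<exists>G :: nat pair_pre_digraph. pair_graph G \<and> planar G \<and> triangle_free G \<and>
      (\<forall>col. coloring G 2 col \<longrightarrow>
         (\<exists>H. mono_component G col H \<and> graph_diameter H \<ge> ereal (real l)))"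
    by blast
next
  have colours3: "spread l (gadget (\<lambda>_ _. True) l (4 * l + 2)) col" if "\<And>z. col z < 3" for col
    using that by (rule three_colours_spread) simp
  obtain G :: "nat pair_pre_digraph" and g :: "complex \<Rightarrow> nat" where G:
      "pair_graph G" "planar G"
      "\<forall>col. coloring G 3 col \<longrightarrow> (\<exists>H. mono_component G col H \<and> ereal (real l) \<le> graph_diameter H)"
    by (rule nat_copy_of_gadget [OF assms zero_less_numeral colours3]) blast+
  then show "\<exists>G' :: nat pair_pre_digraph. pair_graph G' \<and> planar G' \<and>
      (\<forall>col. coloring G' 3 col \<longrightarrow>
         (\<exists>H. mono_component G' col H \<and> graph_diameter H \<ge> ereal (real l)))"
    by blast
qed

end
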